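(* Let receiver $i$ track at most $K$ peers, with at most $n_{\max}$ probes per peer, and let $\delta\in(0,1)$. Assume local utility drift: over one evidence-retention horizon, $\lvert\mu_{ij}(t)-\mu_{ij}(t')\rvert\le\nu_{ij}\lvert t-t'\rvert$ for a finite drift envelope $\nu_{ij}\ge0$. Then on the event $$\Bigl\{\lvert\widehat\mu_{ij,n}-\bar\mu_{ij,n}\rvert\le r_n\ \text{ for every tracked peer } j \text{ and every } 1\le n\le n_{\max}\Bigr\},\qquad r_n=\sqrt{\frac{\log(2Kn_{\max}/\delta)}{2n}},$$ the current utility satisfies $\mu_{ij}(t)\in[L_{ij,n}(t),U_{ij,n}(t)]$ for every tracked peer--stage pair $(j,n)$, where $$L_{ij,n}(t)=\operatorname{clip}\bigl(\widehat\mu_{ij,n}-r_n-\nu_{ij}\bar a_{ij,n},\,0,\,1\bigr),\qquad U_{ij,n}(t)=\operatorname{clip}\bigl(\widehat\mu_{ij,n}+r_n+\nu_{ij}\bar a_{ij,n},\,0,\,1\bigr).$$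
   Context: For peer $j$, probe $r$ is observed at time $t_{ij,r}\le t$ (within the evidence-retention horizon) with score $X_{ij,r}\in[0,1]$; $\mu_{ij}(t)\in[0,1]$ is the mean compatibility at time $t$, and probe outcomes are conditionally independent given their observation times with mean $\mu_{ij}(t_{ij,r})$. The age of probe $r$ at decision time $t$ is $a_{ij,r}=t-t_{ij,r}$. Define $\widehat\mu_{ij,n}=\frac1n\sum_{r=1}^nX_{ij,r}$, $\bar\mu_{ij,n}=\frac1n\sum_{r=1}^n\mu_{ij}(t_{ij,r})$, $\bar a_{ij,n}=\frac1n\sum_{r=1}^na_{ij,r}$, and $\operatorname{clip}(x,0,1)=\min\{1,\max\{0,x\}\}$. *)

theory Defs
  imports "HOL-Probability.Probability"
begin

definition clip :: "real \<Rightarrow> real \<Rightarrow> real \<Rightarrow> real" where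
  "clip x lo hi = min hi (max lo x)"

(* The sigma-algebra on the sample space generated by the real random variables T r, r in I. *)
definition generated_sigma :: "'w measure \<Rightarrow> nat set \<Rightarrow> (nat \<Rightarrow> 'w \<Rightarrow> real) \<Rightarrow> 'w measure" where
  "generated_sigma M I T =
     sigma (space M) {T r -` A \<inter> space M | r A. r \<in> I \<and> A \<in> sets borel}"

(* Conditional independence given F: conditional probabilities of finite families of events
   factorise, where the conditional probability of an event is the conditional expectation of
   its indicator. *)
definition cond_indep_vars ::
  "'w measure \<Rightarrow> 'w measure \<Rightarrow> nat set \<Rightarrow> (nat \<Rightarrow> 'w \<Rightarrow> real) \<Rightarrow> bool" where
  "cond_indep_vars M F I X \<longleftrightarrow>
     (\<forall>r\<in>I. X r \<in> borel_measurable M) \<and>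
     (\<forall>J A. J \<subseteq> I \<and> finite J \<and> (\<forall>r\<in>J. A r \<in> sets borel) \<longrightarrow>
        (AE \<omega> in M.
           real_cond_exp M F (\<lambda>\<omega>. \<Prod>r\<in>J. indicator (A r) (X r \<omega>)) \<omega> =
           (\<Prod>r\<in>J. real_cond_exp M F (\<lambda>\<omega>. indicator (A r) (X r \<omega>)) \<omega>)))"

(* The evidence of one fixed receiver i (whose index is suppressed) at the decision time t.
   P is the set of tracked peers, H the length of the evidence-retention horizon, and N j the
   number of probes of peer j, which are numbered 1, ..., N j.  T j r and X j r are the random
   observation time and score of probe r; \<mu> j s is the mean compatibility at time s. *)
locale probe_evidence = prob_space M
  for M :: "'w measure" +
  fixes P :: "'p set"
    and N :: "'p \<Rightarrow> nat"
    and T :: "'p \<Rightarrow> nat \<Rightarrow> 'w \<Rightarrow> real"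
    and X :: "'p \<Rightarrow> nat \<Rightarrow> 'w \<Rightarrow> real"
    and \<mu> :: "'p \<Rightarrow> real \<Rightarrow> real"
    and H :: real
    and t :: real
  assumes finite_peers: "finite P"
    and horizon_nonneg: "0 \<le> H"
    and mean_range: "j \<in> P \<Longrightarrow> \<mu> j s \<in> {0..1}"
    and time_measurable: "j \<in> P \<Longrightarrow> r \<in> {1..N j} \<Longrightarrow> T j r \<in> borel_measurable M"
    and time_in_horizon:
      "j \<in> P \<Longrightarrow> r \<in> {1..N j} \<Longrightarrow> \<omega> \<in> space M \<Longrightarrow> T j r \<omega> \<in> {t - H..t}"
    and score_measurable: "j \<in> P \<Longrightarrow> r \<in> {1..N j} \<Longrightarrow> X j r \<in> borel_measurable M"
    and score_range:
      "j \<in> P \<Longrightarrow> r \<in> {1..N j} \<Longrightarrow> \<omega> \<in> space M \<Longrightarrow> X j r \<omega> \<in> {0..1}"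
    and score_cond_indep:
      "j \<in> P \<Longrightarrow>
         cond_indep_vars M (generated_sigma M {1..N j} (T j)) {1..N j} (X j)"
    and score_cond_mean:
      "j \<in> P \<Longrightarrow> r \<in> {1..N j} \<Longrightarrow>
         AE \<omega> in M. real_cond_exp M (generated_sigma M {1..N j} (T j)) (X j r) \<omega> =
                     \<mu> j (T j r \<omega>)"

definition mu_hat :: "('p \<Rightarrow> nat \<Rightarrow> 'w \<Rightarrow> real) \<Rightarrow> 'p \<Rightarrow> nat \<Rightarrow> 'w \<Rightarrow> real" where
  "mu_hat X j n \<omega> = (1 / real n) * (\<Sum>r = 1..n. X j r \<omega>)"

definition mu_bar ::
  "('p \<Rightarrow> real \<Rightarrow> real) \<Rightarrow> ('p \<Rightarrow> nat \<Rightarrow> 'w \<Rightarrow> real) \<Rightarrow> 'p \<Rightarrow> nat \<Rightarrow> 'w \<Rightarrow> real" where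
  "mu_bar \<mu> T j n \<omega> = (1 / real n) * (\<Sum>r = 1..n. \<mu> j (T j r \<omega>))"

definition age :: "('p \<Rightarrow> nat \<Rightarrow> 'w \<Rightarrow> real) \<Rightarrow> real \<Rightarrow> 'p \<Rightarrow> nat \<Rightarrow> 'w \<Rightarrow> real" where
  "age T t j r \<omega> = t - T j r \<omega>"

definition age_bar :: "('p \<Rightarrow> nat \<Rightarrow> 'w \<Rightarrow> real) \<Rightarrow> real \<Rightarrow> 'p \<Rightarrow> nat \<Rightarrow> 'w \<Rightarrow> real" where
  "age_bar T t j n \<omega> = (1 / real n) * (\<Sum>r = 1..n. age T t j r \<omega>)"

definition radius :: "nat \<Rightarrow> nat \<Rightarrow> real \<Rightarrow> nat \<Rightarrow> real" where
  "radius K nmax \<delta> n = sqrt (ln (2 * real K * real nmax / \<delta>) / (2 * real n))"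

definition lower_bound ::
  "nat \<Rightarrow> nat \<Rightarrow> real \<Rightarrow> ('p \<Rightarrow> real) \<Rightarrow> ('p \<Rightarrow> nat \<Rightarrow> 'w \<Rightarrow> real) \<Rightarrow>
   ('p \<Rightarrow> nat \<Rightarrow> 'w \<Rightarrow> real) \<Rightarrow> real \<Rightarrow> 'p \<Rightarrow> nat \<Rightarrow> 'w \<Rightarrow> real" where
  "lower_bound K nmax \<delta> \<nu> T X t j n \<omega> =
     clip (mu_hat X j n \<omega> - radius K nmax \<delta> n - \<nu> j * age_bar T t j n \<omega>) 0 1"

definition upper_bound ::
  "nat \<Rightarrow> nat \<Rightarrow> real \<Rightarrow> ('p \<Rightarrow> real) \<Rightarrow> ('p \<Rightarrow> nat \<Rightarrow> 'w \<Rightarrow> real) \<Rightarrow>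
   ('p \<Rightarrow> nat \<Rightarrow> 'w \<Rightarrow> real) \<Rightarrow> real \<Rightarrow> 'p \<Rightarrow> nat \<Rightarrow> 'w \<Rightarrow> real" where
  "upper_bound K nmax \<delta> \<nu> T X t j n \<omega> =
     clip (mu_hat X j n \<omega> + radius K nmax \<delta> n + \<nu> j * age_bar T t j n \<omega>) 0 1"

(* A peer may have fewer than nmax probes; the confidence bound is only required at the stages
   n \<le> N j whose n probes exist.  With N j = nmax for all j, every stage 1, ..., nmax occurs. *)
definition confidence_event ::
  "'w measure \<Rightarrow> 'p set \<Rightarrow> ('p \<Rightarrow> nat) \<Rightarrow> nat \<Rightarrow> nat \<Rightarrow> real \<Rightarrow>
   ('p \<Rightarrow> nat \<Rightarrow> 'w \<Rightarrow> real) \<Rightarrow> ('p \<Rightarrow> nat \<Rightarrow> 'w \<Rightarrow> real) \<Rightarrow> ('p \<Rightarrow> real \<Rightarrow> real) \<Rightarrow> 'w set" where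
  "confidence_event M P N K nmax \<delta> T X \<mu> =
     {\<omega> \<in> space M. \<forall>j\<in>P. \<forall>n\<in>{1..nmax}. n \<le> N j \<longrightarrow>
        \<bar>mu_hat X j n \<omega> - mu_bar \<mu> T j n \<omega>\<bar> \<le> radius K nmax \<delta> n}"

end

theory Submission
  imports Defs
begin

text \<open>Fix \<omega> in the event and compare both \<open>\<mu> j t\<close> and
  \<open>mu_hat\<close> with \<open>mu_bar\<close>. The event bounds the distance from
  \<open>mu_hat\<close> to \<open>mu_bar\<close> by the radius. Drift moves each probe mean away
  from \<open>\<mu> j t\<close> by at most \<open>\<nu> j\<close> times the age of the probe, so
  averaging bounds the second distance by \<open>\<nu> j\<close> times the mean age
  (\<open>mu_bar_drift\<close>). The triangle inequality adds the two errors. Clipping is monotone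
  and fixes every point of [0,1], \<open>\<mu> j t\<close> among them, so it keeps the enclosure
  (\<open>clip_enclosure\<close>).\<close>

lemma clip_enclosure:
  assumes "x \<in> {0..1}" and "\<bar>x - m\<bar> \<le> b" and "\<bar>h - m\<bar> \<le> r"
  shows "x \<in> {clip (h - r - b) 0 1..clip (h + r + b) 0 1}"
  using assms by (auto simp: clip_def)

text \<open>An envelope linear in the age passes to averages, which is why only the mean age enters
  the bias term.\<close>

lemma mu_bar_drift:
  assumes "0 < n"
    and "\<And>r. r \<in> {1..n} \<Longrightarrow> \<bar>\<mu> j t - \<mu> j (T j r \<omega>)\<bar> \<le> c * age T t j r \<omega>"
  shows "\<bar>\<mu> j t - mu_bar \<mu> T j n \<omega>\<bar> \<le> c * age_bar T t j n \<omega>"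
proof -
  \<comment> \<open>Since n > 0, \<open>\<mu> j t\<close> is the average of n copies of
    itself.\<close>
  have "\<mu> j t - mu_bar \<mu> T j n \<omega> = (\<Sum>r = 1..n. \<mu> j t - \<mu> j (T j r \<omega>)) / real n"
    using assms(1) by (simp add: mu_bar_def sum_subtractf field_simps)
  also have "\<bar>\<dots>\<bar> \<le> (\<Sum>r = 1..n. c * age T t j r \<omega>) / real n"
    using assms(2) by (auto intro!: divide_right_mono order_trans[OF sum_abs] sum_mono)
  also have "\<dots> = c * age_bar T t j n \<omega>"
    by (simp add: age_bar_def flip: sum_distrib_left)
  finally show ?thesis .
qed

theorem lemma3:
  fixes M :: "'w measure" and P :: "'p set" and N :: "'p \<Rightarrow> nat"
    and T X :: "'p \<Rightarrow> nat \<Rightarrow> 'w \<Rightarrow> real" and \<mu> :: "'p \<Rightarrow> real \<Rightarrow> real"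
    and \<nu> :: "'p \<Rightarrow> real" and H t \<delta> :: real and K nmax :: nat
  assumes "probe_evidence M P N T X \<mu> H t"
    and "card P \<le> K"
    and "\<And>j. j \<in> P \<Longrightarrow> N j \<le> nmax"
    and "0 < \<delta>" and "\<delta> < 1"
    and "\<And>j. j \<in> P \<Longrightarrow> 0 \<le> \<nu> j"
    and "\<And>j s s'. j \<in> P \<Longrightarrow> s \<in> {t - H..t} \<Longrightarrow> s' \<in> {t - H..t} \<Longrightarrow>
           \<bar>\<mu> j s - \<mu> j s'\<bar> \<le> \<nu> j * \<bar>s - s'\<bar>"
  shows "\<forall>\<omega> \<in> confidence_event M P N K nmax \<delta> T X \<mu>.
           \<forall>j\<in>P. \<forall>n\<in>{1..nmax}. n \<le> N j \<longrightarrow>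
             \<mu> j t \<in> {lower_bound K nmax \<delta> \<nu> T X t j n \<omega>..upper_bound K nmax \<delta> \<nu> T X t j n \<omega>}"
proof (intro ballI impI)
  fix \<omega> j n
  assume \<omega>: "\<omega> \<in> confidence_event M P N K nmax \<delta> T X \<mu>"
    and j: "j \<in> P" and n: "n \<in> {1..nmax}" "n \<le> N j"
  interpret probe_evidence M P N T X \<mu> H t
    by fact
  have "\<bar>\<mu> j t - mu_bar \<mu> T j n \<omega>\<bar> \<le> \<nu> j * age_bar T t j n \<omega>"
  proof (rule mu_bar_drift)
    fix r assume "r \<in> {1..n}"
    \<comment> \<open>Probe r exists because r \<le> n \<le> \<open>N j\<close>, and the event lies
      in \<open>space M\<close>.\<close>
    then have "T j r \<omega> \<in> {t - H..t}"
      using \<omega> j n by (intro time_in_horizon) (auto simp: confidence_event_def)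
    \<comment> \<open>As 0 \<le> H, the decision time t itself lies in the horizon, so drift applies
      between t and the probe time; no probe is later than t, so their distance is the age.\<close>
    then show "\<bar>\<mu> j t - \<mu> j (T j r \<omega>)\<bar> \<le> \<nu> j * age T t j r \<omega>"
      using assms(7)[OF j, of t "T j r \<omega>"] horizon_nonneg by (simp add: age_def)
  qed (use n in simp)
  moreover have "\<bar>mu_hat X j n \<omega> - mu_bar \<mu> T j n \<omega>\<bar> \<le> radius K nmax \<delta> n"
    using \<omega> j n by (simp add: confidence_event_def)
  ultimately show
    "\<mu> j t \<in> {lower_bound K nmax \<delta> \<nu> T X t j n \<omega>..upper_bound K nmax \<delta> \<nu> T X t j n \<omega>}"
    unfolding lower_bound_def upper_bound_def by (rule clip_enclosure[OF mean_range[OF j]])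
qed

end
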